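(* Let $k$ be a field, $\mathfrak{j}=(X^{\gamma_1},\dots,X^{\gamma_t})\subset k[X_0,\dots,X_n]$ a monomial ideal with monomial basis $X^{\gamma_1},\dots,X^{\gamma_t}$, $\prec$ a fixed term ordering, and $T=\{T_1,\dots,T_t\}$, where each $T_i$ is a finite subset of the tail of $X^{\gamma_i}$ with respect to $\mathfrak{j}$. Then the ideal $\mathfrak{h}(\mathfrak{j},T)\subset k[C]$ defining the Gröbner stratum $\mathcal{S}t(\mathfrak{j},T)$ does not depend on the choices made in its construction (in particular, on the choices of the reductions of the $S$-polynomials).
   Context: Monomials of $k[X]=k[X_0,\dots,X_n]$ are written $X^\alpha$; $\prec$ is a term ordering with $X_0\succ\dots\succ X_n$. The tail of $X^{\gamma}$ with respect to $\mathfrak{j}$ is the set of monomials $X^\alpha$ with $X^\alpha\prec X^\gamma$ and $X^\alpha\notin\mathfrak{j}$. Let $C=\{C_{i\alpha} : 1\le i\le t,\ X^\alpha\in T_i\}$ be new variables and put $F_i=X^{\gamma_i}+\sum_{X^\alpha\in T_i}C_{i\alpha}X^\alpha\in k[X,C]$, $\mathcal{B}=\{F_1,\dots,F_t\}$. For $G\in k[X,C]$, its $X$-monomials are the monomials in $X$ appearing in $G$ viewed as a polynomial in $X$ over $k[C]$, and its $X$-coefficients are their coefficients in $k[C]$. Fix a term ordering on $k[X,C]$ that is an elimination order for the variables $X$ and coincides with $\prec$ on monomials in $X$; then $X^{\gamma_i}$ is the leading term of $F_i$. Construction of $\mathfrak{h}(\mathfrak{j},T)$: choose a set $P$ of pairs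 $(i,j)$, $1\le i<j\le t$, whose corresponding syzygies generate the module of syzygies $\mathrm{Syz}(\mathfrak{j})$ of $(X^{\gamma_1},\dots,X^{\gamma_t})$; for each $(i,j)\in P$ choose a complete reduction $R_{ij}$ of the $S$-polynomial $S(F_i,F_j)$ with respect to $\mathcal{B}$ (obtained by successive division steps by elements of $\mathcal B$ until no $X$-monomial lies in $\mathfrak{j}$; in general it is not uniquely determined because $\mathcal B$ need not be a Gröbner basis). Then $\mathfrak{h}(\mathfrak{j},T)$ is the ideal of $k[C]$ generated by the $X$-coefficients of all $R_{ij}$, $(i,j)\in P$. The Gröbner stratum $\mathcal{S}t(\mathfrak{j},T)$ is the subscheme of the affine space with coordinates $C$ defined by $\mathfrak{h}(\mathfrak{j},T)$; it parameterizes the ideals with initial ideal $\mathfrak{j}$ whose reduced Gröbner basis is of the form $f_i=X^{\gamma_i}+\sum_{X^\alpha\in T_i}c_{i\alpha}X^\alpha$, $c_{i\alpha}\in k$. *)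

theory Defs
  imports "HOL-Algebra.Ideal" "HOL-Library.Poly_Mapping" "HOL-Library.Product_Plus"
begin

section \<open>Polynomials\<close>

text \<open>
  A monomial is an exponent vector of type \<open>'v \<Rightarrow>\<^sub>0 nat\<close>; a product of monomials is a sum of
  exponent vectors.  The variables \<open>X\<^sub>0, \<dots>, X\<^sub>n\<close> are indexed by an arbitrary (automatically
  nonempty) finite linearly ordered type \<open>'n\<close>, smaller indices coming first.  The
  variable \<open>C\<^bsub>i\<alpha>\<^esub>\<close> has the index \<open>(i, \<alpha>)\<close>.
\<close>

type_synonym 'v mon = "'v \<Rightarrow>\<^sub>0 nat"
type_synonym ('v, 'k) mpoly = "'v mon \<Rightarrow>\<^sub>0 'k"
type_synonym 'n cvar = "nat \<times> 'n mon"

text \<open>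
  \<open>k[X,C]\<close> is represented as \<open>k[C][X]\<close>: for \<open>G :: ('n, 'k) xcpoly\<close>, the \<open>X\<close>-monomials of \<open>G\<close>
  are \<open>keys G\<close>, and the \<open>X\<close>-coefficient at \<open>X\<^sup>\<alpha>\<close> is \<open>lookup G \<alpha>\<close>.  A monomial
  \<open>X\<^sup>\<alpha> C\<^sup>\<delta>\<close> of \<open>k[X,C]\<close> is the pair \<open>(\<alpha>, \<delta>)\<close>.
\<close>

type_synonym ('n, 'k) xcpoly = "('n, ('n cvar, 'k) mpoly) mpoly"
type_synonym 'n xcmon = "'n mon \<times> 'n cvar mon"

abbreviation monomial :: "'v mon \<Rightarrow> ('v, 'a::comm_ring_1) mpoly"
  where "monomial \<alpha> \<equiv> Poly_Mapping.single \<alpha> 1"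

abbreviation pvar :: "'v \<Rightarrow> 'v mon"
  where "pvar v \<equiv> Poly_Mapping.single v 1"

definition mpoly_ring :: "'v set \<Rightarrow> ('v, 'a::comm_ring_1) mpoly ring"
  where "mpoly_ring V =
    \<lparr>carrier = {p. \<forall>\<alpha> \<in> Poly_Mapping.keys p. Poly_Mapping.keys \<alpha> \<subseteq> V},
     monoid.mult = (*), one = 1, zero = 0, add = (+)\<rparr>"


section \<open>Term orderings\<close>

text \<open>
  Strict term orderings on a set \<open>M\<close> of monomials closed under multiplication.
\<close>

definition term_order :: "'m::comm_monoid_add set \<Rightarrow> ('m \<Rightarrow> 'm \<Rightarrow> bool) \<Rightarrow> bool"
  where "term_order M lt \<longleftrightarrow>
    irreflp_on M lt \<and> transp_on M lt \<and> totalp_on M lt \<and>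
    (\<forall>a \<in> M. a \<noteq> 0 \<longrightarrow> lt 0 a) \<and>
    (\<forall>a \<in> M. \<forall>b \<in> M. \<forall>c \<in> M. lt a b \<longrightarrow> lt (a + c) (b + c))"


section \<open>Monomial ideals, tails and the generic polynomials\<close>

text \<open>
  \<open>X\<^bsup>\<gamma> 1\<^esup>, \<dots>, X\<^bsup>\<gamma> t\<^esup>\<close> is the monomial basis of \<open>\<jj>\<close>, i.e. a minimal (irredundant, hence
  repetition-free) system of monomial generators.
\<close>

definition monomial_basis ::
    "('n, 'k::field) mpoly set \<Rightarrow> nat \<Rightarrow> (nat \<Rightarrow> 'n mon) \<Rightarrow> bool"
  where "monomial_basis \<jj> t \<gamma> \<longleftrightarrow>
    \<jj> = genideal (mpoly_ring UNIV) ((\<lambda>i. monomial (\<gamma> i)) ` {1..t}) \<and>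
    (\<forall>i \<in> {1..t}. monomial (\<gamma> i) \<notin>
       genideal (mpoly_ring UNIV) ((\<lambda>l. monomial (\<gamma> l)) ` ({1..t} - {i}) :: ('n, 'k) mpoly set))"

definition tail ::
    "('n mon \<Rightarrow> 'n mon \<Rightarrow> bool) \<Rightarrow> ('n, 'k::field) mpoly set \<Rightarrow> 'n mon \<Rightarrow> 'n mon set"
  where "tail prec \<jj> \<beta> = {\<alpha>. prec \<alpha> \<beta> \<and> monomial \<alpha> \<notin> \<jj>}"

definition Cvars :: "nat \<Rightarrow> (nat \<Rightarrow> 'n mon set) \<Rightarrow> 'n cvar set"
  where "Cvars t T = (SIGMA i:{1..t}. T i)"

definition generic_poly ::
    "(nat \<Rightarrow> 'n mon) \<Rightarrow> (nat \<Rightarrow> 'n mon set) \<Rightarrow> nat \<Rightarrow> ('n, 'k::field) xcpoly"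
  where "generic_poly \<gamma> T i =
    monomial (\<gamma> i) + (\<Sum>\<alpha> \<in> T i. Poly_Mapping.single \<alpha> (monomial (pvar (i, \<alpha>))))"


section \<open>Division and S-polynomials in \<open>k[X,C]\<close>\<close>

definition xcmons :: "'n cvar set \<Rightarrow> 'n xcmon set"
  where "xcmons V = {m. Poly_Mapping.keys (snd m) \<subseteq> V}"

definition xccoeff :: "('n, 'k::field) xcpoly \<Rightarrow> 'n xcmon \<Rightarrow> 'k"
  where "xccoeff G m = Poly_Mapping.lookup (Poly_Mapping.lookup G (fst m)) (snd m)"

definition xcterm :: "'k::field \<Rightarrow> 'n xcmon \<Rightarrow> ('n, 'k) xcpoly"
  where "xcterm c m = Poly_Mapping.single (fst m) (Poly_Mapping.single (snd m) c)"

definition lead_mon :: "('n xcmon \<Rightarrow> 'n xcmon \<Rightarrow> bool) \<Rightarrow> ('n, 'k::field) xcpoly \<Rightarrow> 'n xcmon"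
  where "lead_mon lt G =
    (THE m. xccoeff G m \<noteq> 0 \<and> (\<forall>m'. xccoeff G m' \<noteq> 0 \<longrightarrow> m' \<noteq> m \<longrightarrow> lt m' m))"

definition lead_coeff :: "('n xcmon \<Rightarrow> 'n xcmon \<Rightarrow> bool) \<Rightarrow> ('n, 'k::field) xcpoly \<Rightarrow> 'k"
  where "lead_coeff lt G = xccoeff G (lead_mon lt G)"

text \<open>
  Subtraction of exponent vectors is truncated pointwise, so \<open>b - a\<close> is the exponent vector of
  \<open>lcm(X\<^sup>a, X\<^sup>b) / X\<^sup>a\<close>.
\<close>

definition S_poly ::
    "('n xcmon \<Rightarrow> 'n xcmon \<Rightarrow> bool) \<Rightarrow> ('n, 'k::field) xcpoly \<Rightarrow> ('n, 'k) xcpoly \<Rightarrow> ('n, 'k) xcpoly"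
  where "S_poly lt F G =
    xcterm (1 / lead_coeff lt F) (lead_mon lt G - lead_mon lt F) * F -
    xcterm (1 / lead_coeff lt G) (lead_mon lt F - lead_mon lt G) * G"

text \<open>
  One division step cancels a single term of \<open>G\<close> that is divisible by the leading term of a member
  of \<open>B\<close>.  Cancelling a whole \<open>X\<close>-coefficient at once amounts to several such steps.
\<close>

definition division_step ::
    "('n xcmon \<Rightarrow> 'n xcmon \<Rightarrow> bool) \<Rightarrow> ('n, 'k::field) xcpoly set \<Rightarrow>
     ('n, 'k) xcpoly \<Rightarrow> ('n, 'k) xcpoly \<Rightarrow> bool"
  where "division_step lt B G H \<longleftrightarrow>
    (\<exists>F \<in> B. \<exists>q. xccoeff G (q + lead_mon lt F) \<noteq> 0 \<and>
       H = G - xcterm (xccoeff G (q + lead_mon lt F) / lead_coeff lt F) q * F)"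

definition complete_reduction ::
    "('n xcmon \<Rightarrow> 'n xcmon \<Rightarrow> bool) \<Rightarrow> ('n, 'k::field) mpoly set \<Rightarrow> ('n, 'k) xcpoly set \<Rightarrow>
     ('n, 'k) xcpoly \<Rightarrow> ('n, 'k) xcpoly \<Rightarrow> bool"
  where "complete_reduction lt \<jj> B G R \<longleftrightarrow>
    (division_step lt B)\<^sup>*\<^sup>* G R \<and> (\<forall>\<alpha> \<in> Poly_Mapping.keys R. monomial \<alpha> \<notin> \<jj>)"


section \<open>Syzygies of the monomial basis\<close>

definition syzygies :: "nat \<Rightarrow> (nat \<Rightarrow> 'n mon) \<Rightarrow> (nat \<Rightarrow> ('n, 'k::field) mpoly) set"
  where "syzygies t \<gamma> =
    {s. (\<forall>i. i \<notin> {1..t} \<longrightarrow> s i = 0) \<and> (\<Sum>i = 1..t. s i * monomial (\<gamma> i)) = 0}"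

definition pair_syzygy ::
    "(nat \<Rightarrow> 'n mon) \<Rightarrow> nat \<times> nat \<Rightarrow> nat \<Rightarrow> ('n, 'k::field) mpoly"
  where "pair_syzygy \<gamma> = (\<lambda>(i, j) l.
    if l = i then monomial (\<gamma> j - \<gamma> i) else if l = j then - monomial (\<gamma> i - \<gamma> j) else 0)"

definition generates_syzygies ::
    "nat \<Rightarrow> (nat \<Rightarrow> 'n mon) \<Rightarrow> (nat \<times> nat) set \<Rightarrow> 'k::field itself \<Rightarrow> bool"
  where "generates_syzygies t \<gamma> P _ \<longleftrightarrow>
    (\<forall>s :: nat \<Rightarrow> ('n, 'k) mpoly. s \<in> syzygies t \<gamma> \<longrightarrow>
       (\<exists>q. \<forall>l. s l = (\<Sum>p \<in> P. q p * pair_syzygy \<gamma> p l)))"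


section \<open>The ideal of the stratum\<close>

text \<open>
  The term orderings on \<open>k[X,C]\<close> that may be used.  If elimination is understood weakly
  (every monomial involving some \<open>X\<close> exceeds every monomial in the \<open>C\<close> alone), then the last
  condition does not follow from the others; for orders that compare the \<open>X\<close>-parts first it
  does, see \<open>xc_order_blockI\<close>.
\<close>

definition xc_order ::
    "('n mon \<Rightarrow> 'n mon \<Rightarrow> bool) \<Rightarrow> nat \<Rightarrow> (nat \<Rightarrow> 'n mon) \<Rightarrow> (nat \<Rightarrow> 'n mon set) \<Rightarrow>
     'k::field itself \<Rightarrow> ('n xcmon \<Rightarrow> 'n xcmon \<Rightarrow> bool) \<Rightarrow> bool"
  where "xc_order prec t \<gamma> T _ lt \<longleftrightarrow>
    term_order (xcmons (Cvars t T)) lt \<and>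
    (\<forall>(\<alpha>, \<delta>) \<in> xcmons (Cvars t T). \<forall>(\<beta>, \<epsilon>) \<in> xcmons (Cvars t T).
       \<alpha> \<noteq> 0 \<and> \<beta> = 0 \<longrightarrow> lt (\<beta>, \<epsilon>) (\<alpha>, \<delta>)) \<and>
    (\<forall>\<alpha> \<beta>. lt (\<alpha>, 0) (\<beta>, 0) \<longleftrightarrow> prec \<alpha> \<beta>) \<and>
    (\<forall>i \<in> {1..t}. lead_mon lt (generic_poly \<gamma> T i :: ('n, 'k) xcpoly) = (\<gamma> i, 0))"

text \<open>
  The data chosen in the construction: a term ordering \<open>lt\<close> on \<open>k[X,C]\<close>, a set \<open>P\<close> of pairs, and
  a complete reduction \<open>R (i, j)\<close> for every \<open>(i, j) \<in> P\<close>.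
\<close>

definition stratum_choice ::
    "('n mon \<Rightarrow> 'n mon \<Rightarrow> bool) \<Rightarrow> ('n, 'k::field) mpoly set \<Rightarrow> nat \<Rightarrow> (nat \<Rightarrow> 'n mon) \<Rightarrow>
     (nat \<Rightarrow> 'n mon set) \<Rightarrow> ('n xcmon \<Rightarrow> 'n xcmon \<Rightarrow> bool) \<Rightarrow> (nat \<times> nat) set \<Rightarrow>
     (nat \<times> nat \<Rightarrow> ('n, 'k) xcpoly) \<Rightarrow> bool"
  where "stratum_choice prec \<jj> t \<gamma> T lt P R \<longleftrightarrow>
    xc_order prec t \<gamma> T TYPE('k) lt \<and>
    P \<subseteq> {(i, j). 1 \<le> i \<and> i < j \<and> j \<le> t} \<and>
    generates_syzygies t \<gamma> P TYPE('k) \<and>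
    (\<forall>(i, j) \<in> P. complete_reduction lt \<jj> (generic_poly \<gamma> T ` {1..t})
       (S_poly lt (generic_poly \<gamma> T i) (generic_poly \<gamma> T j)) (R (i, j)))"

definition stratum_ideal ::
    "nat \<Rightarrow> (nat \<Rightarrow> 'n mon set) \<Rightarrow> (nat \<times> nat) set \<Rightarrow> (nat \<times> nat \<Rightarrow> ('n, 'k::field) xcpoly) \<Rightarrow>
     ('n cvar, 'k) mpoly set"
  where "stratum_ideal t T P R =
    genideal (mpoly_ring (Cvars t T))
      {Poly_Mapping.lookup (R p) \<alpha> | p \<alpha>. p \<in> P \<and> \<alpha> \<in> Poly_Mapping.keys (R p)}"

lemma xc_order_blockI:
  fixes prec :: "'n mon \<Rightarrow> 'n mon \<Rightarrow> bool" and \<jj> :: "('n, 'k::field) mpoly set"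
  assumes prec: "term_order UNIV prec"
    and fin: "\<And>i. i \<in> {1..t} \<Longrightarrow> finite (T i)"
    and tails: "\<And>i. i \<in> {1..t} \<Longrightarrow> T i \<subseteq> tail prec \<jj> (\<gamma> i)"
    and lt: "term_order (xcmons (Cvars t T)) lt"
    and block: "\<And>\<alpha> \<beta> \<delta> \<epsilon>. (\<alpha>, \<delta>) \<in> xcmons (Cvars t T) \<Longrightarrow> (\<beta>, \<epsilon>) \<in> xcmons (Cvars t T) \<Longrightarrow>
      prec \<alpha> \<beta> \<Longrightarrow> lt (\<alpha>, \<delta>) (\<beta>, \<epsilon>)"
  shows "xc_order prec t \<gamma> T TYPE('k) lt"
proof -
  have irr: "\<not> prec \<alpha> \<alpha>" for \<alpha>
    using prec by (auto simp: term_order_def irreflp_on_def)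
  have tot: "prec \<alpha> \<beta> \<or> prec \<beta> \<alpha>" if "\<alpha> \<noteq> \<beta>" for \<alpha> \<beta>
    using prec that by (auto simp: term_order_def totalp_on_def)
  have pos: "prec 0 \<alpha>" if "\<alpha> \<noteq> 0" for \<alpha>
    using prec that by (auto simp: term_order_def)
  have mem: "(\<alpha>, 0) \<in> xcmons (Cvars t T)" for \<alpha>
    by (simp add: xcmons_def)
  have irr': "\<not> lt m m" if "m \<in> xcmons (Cvars t T)" for m
    using lt that by (auto simp: term_order_def irreflp_on_def)
  have asym': "\<not> lt m' m" if "m \<in> xcmons (Cvars t T)" "m' \<in> xcmons (Cvars t T)" "lt m m'" for m m'
  proof
    assume "lt m' m"
    with lt that have "lt m m" unfolding term_order_def transp_on_def by blast
    with irr' that show False by blast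
  qed
  have coinc: "lt (\<alpha>, 0) (\<beta>, 0) \<longleftrightarrow> prec \<alpha> \<beta>" for \<alpha> \<beta>
    using block[OF mem mem] asym'[OF mem mem] irr'[OF mem] tot by metis
  have lead: "lead_mon lt (generic_poly \<gamma> T i :: ('n, 'k) xcpoly) = (\<gamma> i, 0)" if i: "i \<in> {1..t}" for i
  proof -
    let ?F = "generic_poly \<gamma> T i :: ('n, 'k) xcpoly"
    have Ti: "prec \<alpha> (\<gamma> i)" if "\<alpha> \<in> T i" for \<alpha>
      using tails[OF i] that by (auto simp: tail_def)
    then have notin: "\<gamma> i \<notin> T i" using irr by blast
    have look: "Poly_Mapping.lookup ?F \<beta> =
        (if \<beta> = \<gamma> i then 1 else if \<beta> \<in> T i then monomial (pvar (i, \<beta>)) else 0)" for \<beta>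
      using notin fin[OF i]
      by (auto simp: generic_poly_def lookup_add lookup_sum lookup_single when_def sum.delta)
    have c1: "xccoeff ?F (\<gamma> i, 0) \<noteq> 0"
      by (simp add: xccoeff_def look lookup_one)
    have c2: "lt m (\<gamma> i, 0)" if nz: "xccoeff ?F m \<noteq> 0" and ne: "m \<noteq> (\<gamma> i, 0)" for m
    proof -
      obtain \<beta> \<delta> where m: "m = (\<beta>, \<delta>)" by force
      have "\<beta> \<in> T i \<and> \<delta> = pvar (i, \<beta>)"
        using nz ne unfolding m xccoeff_def
        by (auto simp: look lookup_one lookup_single when_def split: if_splits)
      then have "prec \<beta> (\<gamma> i)" "(\<beta>, \<delta>) \<in> xcmons (Cvars t T)"
        using Ti i by (auto simp: xcmons_def Cvars_def)
      then show ?thesis using block mem m by blast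
    qed
    show ?thesis
      unfolding lead_mon_def
    proof (rule the_equality)
      show "xccoeff ?F (\<gamma> i, 0) \<noteq> 0 \<and>
          (\<forall>m'. xccoeff ?F m' \<noteq> 0 \<longrightarrow> m' \<noteq> (\<gamma> i, 0) \<longrightarrow> lt m' (\<gamma> i, 0))"
        using c1 c2 by blast
    next
      fix m
      assume m: "xccoeff ?F m \<noteq> 0 \<and> (\<forall>m'. xccoeff ?F m' \<noteq> 0 \<longrightarrow> m' \<noteq> m \<longrightarrow> lt m' m)"
      show "m = (\<gamma> i, 0)"
      proof (rule ccontr)
        assume ne: "m \<noteq> (\<gamma> i, 0)"
        obtain \<beta> \<delta> where md: "m = (\<beta>, \<delta>)" by force
        have "\<beta> \<in> T i \<and> \<delta> = pvar (i, \<beta>)"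
          using m ne unfolding md xccoeff_def
          by (auto simp: look lookup_one lookup_single when_def split: if_splits)
        then have "m \<in> xcmons (Cvars t T)"
          using md i by (auto simp: xcmons_def Cvars_def)
        then show False using m ne c1 c2 asym' mem by metis
      qed
    qed
  qed
  show ?thesis
    unfolding xc_order_def using lt coinc lead block pos by auto
qed

end

(*
  Fix an ideal I of k[C] that contains the X-coefficients of all R_p, p in P, and compute modulo I.
  A reduction step only changes X-monomials below the lcm, so S(F_i, F_j) is a combination of
  products X^d F_l with d + g_l below lcm(X^(g_i), X^(g_j)), for (i, j) in P and then, because P
  generates the syzygies, for all i, j.  Hence, as in Buchberger's criterion, modulo I every such
  combination can be rewritten with a single product for each leading X-monomial, and it vanishes
  if none of its X-monomials is in j.  This applies to every R'_p, p in P', so its X-coefficients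
  lie in I.  Taking the intersection over all I gives one inclusion, and the other is symmetric.
*)
theory Submission
  imports Complex_Main Defs
begin

section \<open>Coefficients of a term times a polynomial, and divisibility of monomials\<close>

lemma lookup_single_mult_shift [simp]:
  fixes G :: "'m::cancel_comm_monoid_add \<Rightarrow>\<^sub>0 'a::semiring_0"
  shows "Poly_Mapping.lookup (Poly_Mapping.single \<delta> c * G) (\<delta> + \<mu>) = c * Poly_Mapping.lookup G \<mu>"
proof -
  have "Poly_Mapping.lookup (Poly_Mapping.single \<delta> c * G) (\<delta> + \<mu>) =
    (\<Sum>l. (c when \<delta> = l) * (\<Sum>q. Poly_Mapping.lookup G q when \<delta> + \<mu> = l + q))"
    by (simp add: lookup_mult lookup_single)
  also have "\<dots> = (\<Sum>l. (c * (\<Sum>q. Poly_Mapping.lookup G q when \<delta> + \<mu> = l + q)) when \<delta> = l)"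
    by (intro arg_cong[of _ _ Sum_any]) (auto simp: when_def)
  also have "\<dots> = c * Poly_Mapping.lookup G \<mu>"
    by simp
  finally show ?thesis .
qed

lemma lookup_single_mult_eq_0:
  fixes G :: "'m::cancel_comm_monoid_add \<Rightarrow>\<^sub>0 'a::semiring_0"
  assumes "\<And>\<mu>. \<beta> \<noteq> \<delta> + \<mu>"
  shows "Poly_Mapping.lookup (Poly_Mapping.single \<delta> c * G) \<beta> = 0"
proof -
  have "Poly_Mapping.lookup (Poly_Mapping.single \<delta> c * G) \<beta> =
    (\<Sum>l. (c when \<delta> = l) * (\<Sum>q. Poly_Mapping.lookup G q when \<beta> = l + q))"
    by (simp add: lookup_mult lookup_single)
  also have "\<dots> = (\<Sum>l::'m. 0)"
    by (intro arg_cong[of _ _ Sum_any] ext) (auto simp: assms when_def)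
  finally show ?thesis by simp
qed

lemma lookup_single_mult:
  fixes G :: "'v mon \<Rightarrow>\<^sub>0 'a::semiring_0"
  shows "Poly_Mapping.lookup (Poly_Mapping.single \<delta> c * G) \<beta> =
    (if \<exists>\<mu>. \<beta> = \<delta> + \<mu> then c * Poly_Mapping.lookup G (\<beta> - \<delta>) else 0)"
  by (auto simp: lookup_single_mult_eq_0)

lemma mon_dvd_iff:
  fixes \<beta> \<delta> :: "'v mon"
  shows "(\<exists>\<mu>. \<beta> = \<delta> + \<mu>) \<longleftrightarrow> (\<forall>v. Poly_Mapping.lookup \<delta> v \<le> Poly_Mapping.lookup \<beta> v)"
proof
  assume le: "\<forall>v. Poly_Mapping.lookup \<delta> v \<le> Poly_Mapping.lookup \<beta> v"
  have "\<beta> = \<delta> + (\<beta> - \<delta>)"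
    by (rule poly_mapping_eqI) (use le in \<open>simp add: lookup_add lookup_minus\<close>)
  then show "\<exists>\<mu>. \<beta> = \<delta> + \<mu>" ..
qed (auto simp: lookup_add)

text \<open>Since subtraction truncates at 0, both sides are the exponent vector of the lcm, which
  is written in this form throughout.\<close>

lemma mon_lcm_commute:
  fixes a b :: "'v mon"
  shows "(b - a) + a = (a - b) + b"
  by (rule poly_mapping_eqI) (simp add: lookup_add lookup_minus)

section \<open>Dickson's lemma and the well-foundedness of term orderings\<close>

text \<open>Dickson's lemma in sequence form. Coordinates are treated one at a time; passing to a
  further subsequence preserves monotonicity in the earlier ones.\<close>

lemma mono_subsequence_family:
  fixes s :: "nat \<Rightarrow> 'v \<Rightarrow> nat"
  assumes "finite V"
  shows "\<exists>f :: nat \<Rightarrow> nat. strict_mono f \<and> (\<forall>v \<in> V. \<forall>i j. i \<le> j \<longrightarrow> s (f i) v \<le> s (f j) v)"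
  using assms
proof (induction V)
  case empty
  show ?case by (rule exI[of _ "\<lambda>n. n"]) (simp add: strict_mono_def)
next
  case (insert w V)
  then obtain f :: "nat \<Rightarrow> nat" where f: "strict_mono f"
    and f_mono: "\<And>v i j. v \<in> V \<Longrightarrow> i \<le> j \<Longrightarrow> s (f i) v \<le> s (f j) v" by blast
  obtain g :: "nat \<Rightarrow> nat" where g: "strict_mono g" and mono: "monoseq (\<lambda>n. s (f (g n)) w)"
    using seq_monosub[of "\<lambda>n. s (f n) w"] by blast
  show ?case
  proof (cases "\<forall>i j. i \<le> j \<longrightarrow> s (f (g i)) w \<le> s (f (g j)) w")
    case True
    have "strict_mono (\<lambda>n. f (g n))" using f g by (simp add: strict_mono_def)
    then show ?thesis
      using True f_mono strict_mono_leD[OF g] by (intro exI[of _ "\<lambda>n. f (g n)"]) auto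
  next
    case False
    then have dec: "s (f (g j)) w \<le> s (f (g i)) w" if "i \<le> j" for i j
      using mono that unfolding monoseq_def by blast
    \<comment> \<open>A nonincreasing sequence of naturals is constant from the place of its least
      value on, so dropping an initial segment makes it nondecreasing.\<close>
    obtain N where N: "\<And>n. s (f (g N)) w \<le> s (f (g n)) w"
      using ex_has_least_nat[of "\<lambda>_. True" 0 "\<lambda>n. s (f (g n)) w"] by auto
    have const: "s (f (g (n + N))) w = s (f (g N)) w" for n
      using dec[of N "n + N"] N[of "n + N"] by simp
    have "strict_mono (\<lambda>n. f (g (n + N)))" using f g by (simp add: strict_mono_def)
    then show ?thesis
      using const f_mono strict_mono_leD[OF g] by (intro exI[of _ "\<lambda>n. f (g (n + N))"]) auto
  qed
qed

text \<open>By Dickson's lemma, an infinite descending chain contains a later monomial that is a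
  multiple of an earlier one; but a proper multiple is larger.\<close>

lemma term_order_wfp:
  fixes prec :: "'n::finite mon \<Rightarrow> 'n mon \<Rightarrow> bool"
  assumes prec: "term_order UNIV prec"
  shows "wfp prec"
proof -
  have irr: "\<not> prec a a" and pos: "a \<noteq> 0 \<Longrightarrow> prec 0 a"
    and tr: "prec a b \<Longrightarrow> prec b c \<Longrightarrow> prec a c"
    and add: "prec a b \<Longrightarrow> prec (a + c) (b + c)" for a b c
    using prec unfolding term_order_def irreflp_on_def transp_on_def by blast+
  have "\<nexists>s. \<forall>i. prec (s (Suc i)) (s i)"
  proof
    assume "\<exists>s. \<forall>i. prec (s (Suc i)) (s i)"
    then obtain s where s: "\<And>i. prec (s (Suc i)) (s i)" by blast
    have desc: "prec (s (i + Suc d)) (s i)" for i d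
    proof (induction d)
      case 0
      then show ?case using s[of i] by simp
    next
      case (Suc d)
      have "prec (s (i + Suc (Suc d))) (s (i + Suc d))" using s[of "i + Suc d"] by simp
      then show ?case using Suc.IH by (rule tr)
    qed
    obtain f :: "nat \<Rightarrow> nat" where f: "strict_mono f"
      and le: "\<And>v i j. i \<le> j \<Longrightarrow> Poly_Mapping.lookup (s (f i)) v \<le> Poly_Mapping.lookup (s (f j)) v"
      using mono_subsequence_family[of UNIV "\<lambda>i. Poly_Mapping.lookup (s i)"] by auto
    have "f 0 < f 1" using f by (simp add: strict_mono_def)
    then obtain d where d: "f 1 = f 0 + Suc d" by (auto simp: less_iff_Suc_add)
    have desc': "prec (s (f 1)) (s (f 0))" unfolding d by (rule desc)
    obtain \<mu> where \<mu>: "s (f 1) = s (f 0) + \<mu>"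
      using iffD2[OF mon_dvd_iff] le[OF zero_le_one] by blast
    show False
    proof (cases "\<mu> = 0")
      case True
      then show ?thesis using desc' \<mu> irr by simp
    next
      case False
      from add[OF pos[OF this], of "s (f 0)"] have "prec (s (f 0)) (s (f 1))"
        unfolding \<mu> by (simp add: add.commute)
      then show ?thesis using desc' irr tr by blast
    qed
  qed
  then show ?thesis
    unfolding wfp_def wf_iff_no_infinite_down_chain by simp
qed

section \<open>Marked polynomials modulo an ideal of coefficients\<close>

text \<open>In the application \<open>A\<close> is k[C], a proper subring of its type in general,
  since the type admits all variables indexed by \<open>'n cvar\<close>. Hence \<open>I\<close>
  absorbs multiplication by elements of \<open>A\<close> only.\<close>

locale marked_polys =
  fixes prec :: "'n::finite mon \<Rightarrow> 'n mon \<Rightarrow> bool"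
    and t :: nat and \<gamma> :: "nat \<Rightarrow> 'n mon"
    and A I :: "'a::comm_ring_1 set"
    and F :: "nat \<Rightarrow> ('n, 'a) mpoly"
  assumes term_order: "term_order UNIV prec"
    and one_A: "1 \<in> A"
    and add_A: "a \<in> A \<Longrightarrow> b \<in> A \<Longrightarrow> a + b \<in> A"
    and mult_A: "a \<in> A \<Longrightarrow> b \<in> A \<Longrightarrow> a * b \<in> A"
    and uminus_A: "a \<in> A \<Longrightarrow> - a \<in> A"
    and zero_I: "0 \<in> I"
    and add_I: "x \<in> I \<Longrightarrow> y \<in> I \<Longrightarrow> x + y \<in> I"
    and mult_I: "a \<in> A \<Longrightarrow> x \<in> I \<Longrightarrow> a * x \<in> I"
    and lookup_marked: "i \<in> {1..t} \<Longrightarrow> Poly_Mapping.lookup (F i) (\<gamma> i) = 1"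
    and marked_less: "i \<in> {1..t} \<Longrightarrow> \<alpha> \<in> Poly_Mapping.keys (F i) \<Longrightarrow> \<alpha> \<noteq> \<gamma> i \<Longrightarrow> prec \<alpha> (\<gamma> i)"
    and lookup_A: "i \<in> {1..t} \<Longrightarrow> Poly_Mapping.lookup (F i) \<alpha> \<in> A"
begin

lemma prec_irrefl: "\<not> prec a a"
  using term_order by (simp add: term_order_def irreflp_on_def)

lemma prec_trans: "prec a b \<Longrightarrow> prec b c \<Longrightarrow> prec a c"
  using term_order unfolding term_order_def by (meson UNIV_I transp_onD)

lemma prec_total: "a \<noteq> b \<Longrightarrow> prec a b \<or> prec b a"
  using term_order by (simp add: term_order_def totalp_on_def)

lemma prec_add: "prec a b \<Longrightarrow> prec (a + c) (b + c)"
  using term_order by (simp add: term_order_def)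

lemma prec_add_left: "prec a b \<Longrightarrow> prec (c + a) (c + b)"
  using prec_add[of a b c] by (simp add: add.commute)

lemma zero_A: "0 \<in> A"
  using add_A[OF one_A uminus_A[OF one_A]] by simp

lemma uminus_I: "x \<in> I \<Longrightarrow> - x \<in> I"
  using mult_I[OF uminus_A[OF one_A], of x] by simp

lemma mult_I': "x \<in> I \<Longrightarrow> a \<in> A \<Longrightarrow> x * a \<in> I"
  using mult_I[of a x] by (simp add: mult.commute)

definition divisible :: "'n mon \<Rightarrow> bool"
  where "divisible \<beta> \<longleftrightarrow> (\<exists>i \<in> {1..t}. \<exists>\<delta>. \<beta> = \<delta> + \<gamma> i)"

text \<open>An arbitrary but fixed choice, which singles out one product for each possible leading
  monomial.\<close>

definition divisor :: "'n mon \<Rightarrow> nat"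
  where "divisor \<beta> = (SOME i. i \<in> {1..t} \<and> (\<exists>\<delta>. \<beta> = \<delta> + \<gamma> i))"

lemma divisor: "divisible \<beta> \<Longrightarrow> divisor \<beta> \<in> {1..t} \<and> (\<exists>\<delta>. \<beta> = \<delta> + \<gamma> (divisor \<beta>))"
  using someI_ex[of "\<lambda>i. i \<in> {1..t} \<and> (\<exists>\<delta>. \<beta> = \<delta> + \<gamma> i)"]
  unfolding divisor_def divisible_def by blast

text \<open>
  Consists of the polynomials that are congruent, modulo polynomials with all coefficients
  in \<open>I\<close>, to an \<open>A\<close>-linear combination of the products \<open>X\<^sup>\<delta> F\<^sub>i\<close> with \<open>Q i \<delta>\<close>.
\<close>

inductive_set multiples :: "(nat \<Rightarrow> 'n mon \<Rightarrow> bool) \<Rightarrow> ('n, 'a) mpoly set"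
  for Q where
    null: "(\<And>\<beta>. Poly_Mapping.lookup H \<beta> \<in> I) \<Longrightarrow> H \<in> multiples Q"
  | multiple: "i \<in> {1..t} \<Longrightarrow> Q i \<delta> \<Longrightarrow> c \<in> A \<Longrightarrow> Poly_Mapping.single \<delta> c * F i \<in> multiples Q"
  | plus: "G \<in> multiples Q \<Longrightarrow> H \<in> multiples Q \<Longrightarrow> G + H \<in> multiples Q"

text \<open>The bound is strict: that the difference of two products lies in \<open>low\<close> of
  their common leading monomial is the condition of Buchberger's criterion, read modulo
  \<open>I\<close>.\<close>

abbreviation low :: "'n mon \<Rightarrow> ('n, 'a) mpoly set"
  where "low \<mu> \<equiv> multiples (\<lambda>i \<delta>. prec (\<delta> + \<gamma> i) \<mu>)"

abbreviation std :: "'n mon \<Rightarrow> ('n, 'a) mpoly set"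
  where "std \<mu> \<equiv> multiples (\<lambda>i \<delta>. prec (\<delta> + \<gamma> i) \<mu> \<and> i = divisor (\<delta> + \<gamma> i))"

lemma multiples_zero: "0 \<in> multiples Q"
  by (rule multiples.null) (simp add: zero_I)

lemma multiples_subset:
  assumes "\<And>i \<delta> c. i \<in> {1..t} \<Longrightarrow> Q i \<delta> \<Longrightarrow> c \<in> A \<Longrightarrow>
    Poly_Mapping.single \<delta> c * F i \<in> multiples Q'"
  shows "multiples Q \<subseteq> multiples Q'"
proof
  fix G assume "G \<in> multiples Q"
  then show "G \<in> multiples Q'"
    by induction (simp_all add: assms multiples.null multiples.plus)
qed

text \<open>With \<open>a = 1\<close> this gives shifts by a monomial, with
  \<open>\<epsilon> = 0\<close> multiplication by a coefficient.\<close>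

lemma multiples_single_mult:
  assumes "G \<in> multiples Q" and a: "a \<in> A"
    and Q: "\<And>i \<delta>. Q i \<delta> \<Longrightarrow> Q' i (\<epsilon> + \<delta>)"
  shows "Poly_Mapping.single \<epsilon> a * G \<in> multiples Q'"
  using assms(1)
proof induction
  case (null H)
  then show ?case
    by (intro multiples.null) (simp add: lookup_single_mult zero_I mult_I[OF a])
next
  case (multiple i \<delta> c)
  then have "Poly_Mapping.single (\<epsilon> + \<delta>) (a * c) * F i \<in> multiples Q'"
    using Q mult_A[OF a] by (intro multiples.multiple) auto
  then show ?case by (simp add: mult_single mult.assoc[symmetric])
next
  case (plus G H)
  then show ?case by (simp add: distrib_left multiples.plus)
qed

lemma multiples_uminus:
  assumes "G \<in> multiples Q"
  shows "- G \<in> multiples Q"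
proof -
  have "Poly_Mapping.single 0 (- 1) * G \<in> multiples Q"
    using assms by (rule multiples_single_mult) (auto intro: uminus_A one_A)
  then show ?thesis by (simp add: single_uminus)
qed

lemma multiples_diff: "G \<in> multiples Q \<Longrightarrow> H \<in> multiples Q \<Longrightarrow> G - H \<in> multiples Q"
  using multiples.plus[OF _ multiples_uminus, of G Q H] by simp

lemma std_mono: "prec \<mu> \<nu> \<Longrightarrow> std \<mu> \<subseteq> std \<nu>"
  using prec_trans[of _ \<mu> \<nu>] by (auto intro!: multiples_subset multiples.multiple)

lemma low_shift: "G \<in> low \<mu> \<Longrightarrow> monomial \<epsilon> * G \<in> low (\<epsilon> + \<mu>)"
  by (erule multiples_single_mult[OF _ one_A]) (simp add: add.assoc prec_add_left)

section \<open>From a generating set of pairs to all pairs\<close>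

text \<open>
  Join \<open>a\<close> and \<open>b\<close> by an edge if \<open>(a, b) \<in> P\<close> and \<open>lcm(X\<^bsup>\<gamma> a\<^esup>, X\<^bsup>\<gamma> b\<^esup>)\<close> divides \<open>X\<^sup>\<beta>\<close>.  The set \<open>K\<close>
  below is a union of connected components.  Summing the components in \<open>K\<close> of a syzygy of
  degree \<open>\<beta>\<close> is a linear functional that kills the multiples of the pair syzygies in \<open>P\<close>, so it
  kills all syzygies, and \<open>i\<close> and \<open>i'\<close> must lie in the same component.
\<close>

lemma monomial_mult_diff_in_low:
  fixes P :: "(nat \<times> nat) set"
  assumes gen: "generates_syzygies t \<gamma> P TYPE('k::field)"
    and P: "P \<subseteq> {(i, j). 1 \<le> i \<and> i < j \<and> j \<le> t}"
    and S: "\<And>i j. (i, j) \<in> P \<Longrightarrow>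
      monomial (\<gamma> j - \<gamma> i) * F i - monomial (\<gamma> i - \<gamma> j) * F j \<in> low ((\<gamma> j - \<gamma> i) + \<gamma> i)"
    and i: "i \<in> {1..t}" and i': "i' \<in> {1..t}" and eq: "\<delta> + \<gamma> i = \<delta>' + \<gamma> i'"
  shows "monomial \<delta> * F i - monomial \<delta>' * F i' \<in> low (\<delta> + \<gamma> i)"
proof -
  define \<beta> where "\<beta> = \<delta> + \<gamma> i"
  define K where "K = {l \<in> {1..t}. \<exists>\<epsilon>. \<beta> = \<epsilon> + \<gamma> l \<and> monomial \<delta> * F i - monomial \<epsilon> * F l \<in> low \<beta>}"
  have finK: "finite K" by (simp add: K_def)
  have iK: "i \<in> K" using i by (auto simp: K_def \<beta>_def multiples_zero)
  have K_edge: "a \<in> K \<longleftrightarrow> b \<in> K" if p: "(a, b) \<in> P" and \<beta>: "\<beta> = \<mu> + ((\<gamma> b - \<gamma> a) + \<gamma> a)" for a b \<mu>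
  proof -
    have \<beta>a: "\<beta> = (\<mu> + (\<gamma> b - \<gamma> a)) + \<gamma> a" and \<beta>b: "\<beta> = (\<mu> + (\<gamma> a - \<gamma> b)) + \<gamma> b"
      using \<beta> mon_lcm_commute[of "\<gamma> b" "\<gamma> a"] by (simp_all add: add.assoc)
    \<comment> \<open>The relation belonging to the edge, shifted to degree \<open>\<beta>\<close>,
      allows the products with \<open>F a\<close> and \<open>F b\<close> to replace each other in
      the condition defining \<open>K\<close>.\<close>
    have "monomial \<mu> * (monomial (\<gamma> b - \<gamma> a) * F a - monomial (\<gamma> a - \<gamma> b) * F b) \<in> low \<beta>"
      unfolding \<beta> by (rule low_shift[OF S[OF p]])
    then have d: "monomial (\<mu> + (\<gamma> b - \<gamma> a)) * F a - monomial (\<mu> + (\<gamma> a - \<gamma> b)) * F b \<in> low \<beta>"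
      by (simp add: right_diff_distrib mult_single mult.assoc[symmetric])
    have ab: "a \<in> {1..t}" "b \<in> {1..t}" using P p by auto
    have "a \<in> K \<longleftrightarrow> monomial \<delta> * F i - monomial (\<mu> + (\<gamma> b - \<gamma> a)) * F a \<in> low \<beta>"
      using ab \<beta>a by (auto simp: K_def)
    moreover have "b \<in> K \<longleftrightarrow> monomial \<delta> * F i - monomial (\<mu> + (\<gamma> a - \<gamma> b)) * F b \<in> low \<beta>"
      using ab \<beta>b by (auto simp: K_def)
    ultimately show ?thesis
      using multiples.plus[OF _ d] multiples_diff[OF _ d] by fastforce
  qed
  have "i' \<in> K"
  proof (rule ccontr)
    assume i'K: "i' \<notin> K"
    then have ne: "i \<noteq> i'" using iK by auto
    \<comment> \<open>The two factorizations of the monomial \<open>\<beta>\<close>, by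
      \<open>\<gamma> i\<close> and by \<open>\<gamma> i'\<close>, give a syzygy with a single
      component in \<open>K\<close>.\<close>
    define s :: "nat \<Rightarrow> ('n, 'k) mpoly"
      where "s = (\<lambda>l. if l = i then monomial \<delta> else if l = i' then - monomial \<delta>' else 0)"
    have "(\<Sum>l = 1..t. s l * monomial (\<gamma> l)) =
        (\<Sum>l = 1..t. (if l = i then monomial \<delta> * monomial (\<gamma> i) else 0) +
          (if l = i' then - monomial \<delta>' * monomial (\<gamma> i') else 0))"
      by (rule sum.cong) (use ne in \<open>auto simp: s_def\<close>)
    also have "\<dots> = 0"
      using i i' eq by (simp add: sum.distrib mult_single)
    finally have "s \<in> syzygies t \<gamma>"
      using i i' by (auto simp: syzygies_def s_def)
    then obtain q where q: "\<And>l. s l = (\<Sum>p \<in> P. q p * pair_syzygy \<gamma> p l)"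
      using gen unfolding generates_syzygies_def by blast
    \<comment> \<open>For \<open>l\<close> in \<open>K\<close> the monomial
      \<open>\<gamma> l\<close> divides \<open>\<beta>\<close>, so the truncated difference
      \<open>\<beta> - \<gamma> l\<close> is the true quotient.\<close>
    have "(\<Sum>l \<in> K. Poly_Mapping.lookup (s l) (\<beta> - \<gamma> l)) = (\<Sum>l \<in> K. if l = i then 1 else 0)"
      by (rule sum.cong) (use i'K in \<open>auto simp: s_def \<beta>_def\<close>)
    also have "\<dots> = 1" using finK iK by simp
    finally have one: "(\<Sum>l \<in> K. Poly_Mapping.lookup (s l) (\<beta> - \<gamma> l)) = 1" .
    have zero: "(\<Sum>l \<in> K. Poly_Mapping.lookup (q p * pair_syzygy \<gamma> p l) (\<beta> - \<gamma> l)) = 0"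
      if p: "p \<in> P" for p
    proof -
      obtain a b where ab: "p = (a, b)" by force
      have "a \<noteq> b" using P p ab by auto
      define x y where "x = Poly_Mapping.lookup (monomial (\<gamma> b - \<gamma> a) * q p) (\<beta> - \<gamma> a)"
        and "y = Poly_Mapping.lookup (monomial (\<gamma> a - \<gamma> b) * q p) (\<beta> - \<gamma> b)"
      have "(\<Sum>l \<in> K. Poly_Mapping.lookup (q p * pair_syzygy \<gamma> p l) (\<beta> - \<gamma> l)) =
          (\<Sum>l \<in> K. (if l = a then x else 0) + (if l = b then - y else 0))"
        by (rule sum.cong) (use \<open>a \<noteq> b\<close> in \<open>auto simp: pair_syzygy_def ab x_def y_def mult.commute\<close>)
      also have "\<dots> = (if a \<in> K then x else 0) - (if b \<in> K then y else 0)"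
        using finK by (simp add: sum.distrib)
      also have "\<dots> = 0"
      \<comment> \<open>If the lcm divides \<open>\<beta>\<close>, both components pick the same
        coefficient of \<open>q p\<close> with opposite signs, and \<open>K\<close> contains both
        ends or neither. Otherwise the coefficient at an end in \<open>K\<close> vanishes, since the
        quotient there is not a multiple of the cofactor.\<close>
      proof (cases "\<exists>\<mu>. \<beta> = \<mu> + ((\<gamma> b - \<gamma> a) + \<gamma> a)")
        case True
        then obtain \<mu> where \<mu>: "\<beta> = \<mu> + ((\<gamma> b - \<gamma> a) + \<gamma> a)" by blast
        then have "\<beta> = ((\<gamma> b - \<gamma> a) + \<mu>) + \<gamma> a"
          by (simp add: ac_simps)
        then have x: "x = Poly_Mapping.lookup (q p) \<mu>"
          unfolding x_def by simp
        have "\<beta> = ((\<gamma> a - \<gamma> b) + \<mu>) + \<gamma> b"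
          using \<mu> unfolding mon_lcm_commute[of "\<gamma> b" "\<gamma> a"] by (simp add: ac_simps)
        then have y: "y = Poly_Mapping.lookup (q p) \<mu>"
          unfolding y_def by simp
        show ?thesis using K_edge[OF p[unfolded ab] \<mu>] x y by simp
      next
        case False
        have "x = 0" if aK: "a \<in> K"
        proof -
          obtain \<epsilon> where \<epsilon>: "\<beta> = \<epsilon> + \<gamma> a" using aK unfolding K_def by blast
          have "\<epsilon> \<noteq> (\<gamma> b - \<gamma> a) + \<mu>" for \<mu>
            using False \<epsilon> by (metis add.assoc add.commute)
          then show ?thesis unfolding x_def \<epsilon> by (simp add: lookup_single_mult_eq_0)
        qed
        moreover have "y = 0" if bK: "b \<in> K"
        proof -
          obtain \<epsilon> where \<epsilon>: "\<beta> = \<epsilon> + \<gamma> b" using bK unfolding K_def by blast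
          have "\<epsilon> \<noteq> (\<gamma> a - \<gamma> b) + \<mu>" for \<mu>
            using False \<epsilon> unfolding mon_lcm_commute[of "\<gamma> b" "\<gamma> a"] by (metis add.assoc add.commute)
          then show ?thesis unfolding y_def \<epsilon> by (simp add: lookup_single_mult_eq_0)
        qed
        ultimately show ?thesis by simp
      qed
      finally show ?thesis .
    qed
    have "(\<Sum>l \<in> K. Poly_Mapping.lookup (s l) (\<beta> - \<gamma> l)) =
        (\<Sum>p \<in> P. \<Sum>l \<in> K. Poly_Mapping.lookup (q p * pair_syzygy \<gamma> p l) (\<beta> - \<gamma> l))"
      unfolding q lookup_sum by (rule sum.swap)
    also have "\<dots> = 0" by (rule sum.neutral) (use zero in blast)
    finally show False using one by simp
  qed
  then show ?thesis using eq by (auto simp: K_def \<beta>_def)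
qed

section \<open>Representations with one product for each leading monomial\<close>

text \<open>Well-founded induction on \<open>\<mu>\<close>: exchanging a product for the chosen one
  with the same leading monomial \<open>\<beta>\<close> costs a difference in
  \<open>low \<beta>\<close>, and \<open>\<beta>\<close> is below \<open>\<mu>\<close>.\<close>

lemma low_subset_std:
  assumes diff: "\<And>i i' \<delta> \<delta>'. i \<in> {1..t} \<Longrightarrow> i' \<in> {1..t} \<Longrightarrow> \<delta> + \<gamma> i = \<delta>' + \<gamma> i' \<Longrightarrow>
    monomial \<delta> * F i - monomial \<delta>' * F i' \<in> low (\<delta> + \<gamma> i)"
  shows "low \<mu> \<subseteq> std \<mu>"
  using term_order_wfp[OF term_order]
proof (induction \<mu> rule: wfp_induct_rule)
  case (less \<mu>)
  show ?case
  proof (rule multiples_subset)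
    fix i \<delta> c assume i: "i \<in> {1..t}" and pr: "prec (\<delta> + \<gamma> i) \<mu>" and c: "c \<in> A"
    define \<beta> where "\<beta> = \<delta> + \<gamma> i"
    have "divisible \<beta>" using i by (auto simp: divisible_def \<beta>_def)
    then obtain \<delta>' where i': "divisor \<beta> \<in> {1..t}" and \<delta>': "\<beta> = \<delta>' + \<gamma> (divisor \<beta>)"
      using divisor by blast
    let ?G = "monomial \<delta> * F i - monomial \<delta>' * F (divisor \<beta>)"
    have "?G \<in> std \<mu>"
      using diff[OF i i', of \<delta> \<delta>'] \<delta>' less.IH[OF pr] std_mono[OF pr] unfolding \<beta>_def by blast
    then have "Poly_Mapping.single 0 c * ?G \<in> std \<mu>"
      using c by (rule multiples_single_mult) simp
    moreover have "Poly_Mapping.single \<delta>' c * F (divisor \<beta>) \<in> std \<mu>"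
      using i' c pr \<delta>' unfolding \<beta>_def by (intro multiples.multiple) auto
    ultimately have "Poly_Mapping.single 0 c * ?G + Poly_Mapping.single \<delta>' c * F (divisor \<beta>) \<in> std \<mu>"
      by (rule multiples.plus)
    then show "Poly_Mapping.single \<delta> c * F i \<in> std \<mu>"
      by (simp add: right_diff_distrib mult_single mult.assoc[symmetric])
  qed
qed

text \<open>A chosen product is determined by its leading monomial, so products with equal leading
  monomials merge and their coefficients add up.\<close>

lemma std_repr:
  assumes "G \<in> std \<mu>"
  shows "\<exists>B c. finite B \<and> (\<forall>\<beta> \<in> B. divisible \<beta>) \<and> (\<forall>\<beta>. c \<beta> \<in> A) \<and> (\<forall>\<beta>. \<beta> \<notin> B \<longrightarrow> c \<beta> = 0) \<and>
    (\<forall>\<alpha>. Poly_Mapping.lookup (G - (\<Sum>\<beta> \<in> B. Poly_Mapping.single (\<beta> - \<gamma> (divisor \<beta>)) (c \<beta>) * F (divisor \<beta>))) \<alpha> \<in> I)"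
  using assms
proof induction
  case (null H)
  then show ?case
    by (intro exI[of _ "{}"] exI[of _ "\<lambda>_. 0"]) (auto simp: zero_A)
next
  case (multiple i \<delta> c)
  let ?\<beta> = "\<delta> + \<gamma> i"
  have "divisible ?\<beta>" using multiple by (auto simp: divisible_def)
  moreover have "divisor ?\<beta> = i" using multiple by simp
  ultimately show ?case using multiple
    by (intro exI[of _ "{?\<beta>}"] exI[of _ "\<lambda>\<beta>. if \<beta> = ?\<beta> then c else 0"]) (auto simp: zero_A zero_I)
next
  case (plus G H)
  let ?s = "\<lambda>B c. \<Sum>\<beta> \<in> B. Poly_Mapping.single (\<beta> - \<gamma> (divisor \<beta>)) (c \<beta>) * F (divisor \<beta>)"
  from plus.IH(1) obtain B c where B: "finite B" "\<forall>\<beta> \<in> B. divisible \<beta>" "\<forall>\<beta>. c \<beta> \<in> A" "\<forall>\<beta>. \<beta> \<notin> B \<longrightarrow> c \<beta> = 0"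
    "\<forall>\<alpha>. Poly_Mapping.lookup (G - ?s B c) \<alpha> \<in> I"
    by (elim exE conjE) (rule that)
  from plus.IH(2) obtain D d where D: "finite D" "\<forall>\<beta> \<in> D. divisible \<beta>" "\<forall>\<beta>. d \<beta> \<in> A" "\<forall>\<beta>. \<beta> \<notin> D \<longrightarrow> d \<beta> = 0"
    "\<forall>\<alpha>. Poly_Mapping.lookup (H - ?s D d) \<alpha> \<in> I"
    by (elim exE conjE) (rule that)
  \<comment> \<open>Coefficients vanish outside the index sets, so both sums extend to the
    union.\<close>
  have "?s B c = ?s (B \<union> D) c" "?s D d = ?s (B \<union> D) d"
    using B D by (auto intro!: sum.mono_neutral_left)
  then have "G + H - ?s (B \<union> D) (\<lambda>\<beta>. c \<beta> + d \<beta>) = (G - ?s B c) + (H - ?s D d)"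
    by (simp add: single_add distrib_right sum.distrib)
  then have "\<forall>\<alpha>. Poly_Mapping.lookup (G + H - ?s (B \<union> D) (\<lambda>\<beta>. c \<beta> + d \<beta>)) \<alpha> \<in> I"
    using B(5) D(5) add_I by (simp only: lookup_add simp_thms)
  moreover have "\<forall>\<beta>. c \<beta> + d \<beta> \<in> A" "finite (B \<union> D)" "\<forall>\<beta> \<in> B \<union> D. divisible \<beta>"
    "\<forall>\<beta>. \<beta> \<notin> B \<union> D \<longrightarrow> c \<beta> + d \<beta> = 0"
    using B D add_A by auto
  ultimately show ?case
    by (intro exI[of _ "B \<union> D"] exI[of _ "\<lambda>\<beta>. c \<beta> + d \<beta>"] conjI)
qed

text \<open>
  The summands have pairwise different leading monomials \<open>\<beta>\<close> with coefficient 1, so the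
  coefficient of the largest one can be read off from \<open>G\<close>.
\<close>

lemma lookup_in_I_if_sum:
  assumes "finite B" "\<forall>\<beta> \<in> B. divisible \<beta>" "\<forall>\<beta>. c \<beta> \<in> A"
    and H: "\<And>\<alpha>. Poly_Mapping.lookup H \<alpha> \<in> I"
    and G: "G = (\<Sum>\<beta> \<in> B. Poly_Mapping.single (\<beta> - \<gamma> (divisor \<beta>)) (c \<beta>) * F (divisor \<beta>)) + H"
    and div: "\<And>\<alpha>. divisible \<alpha> \<Longrightarrow> Poly_Mapping.lookup G \<alpha> \<in> I"
  shows "Poly_Mapping.lookup G \<alpha> \<in> I"
  using assms
proof (induction "card B" arbitrary: B G \<alpha>)
  case 0
  then show ?case by simp
next
  case (Suc n)
  let ?f = "\<lambda>\<beta>. Poly_Mapping.single (\<beta> - \<gamma> (divisor \<beta>)) (c \<beta>) * F (divisor \<beta>)"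
  have "B \<noteq> {}" using Suc.hyps by auto
  have "asymp_on B prec"
    by (rule asymp_onI) (metis prec_irrefl prec_trans)
  moreover have "transp_on B prec"
    by (rule transp_onI) (rule prec_trans)
  ultimately obtain \<mu> where \<mu>: "\<mu> \<in> B" and max: "\<And>\<beta>. \<beta> \<in> B \<Longrightarrow> \<not> prec \<mu> \<beta>"
    using Finite_Set.bex_max_element[OF Suc.prems(1) _ _ \<open>B \<noteq> {}\<close>, of prec] prec_irrefl by metis
  \<comment> \<open>A monomial of a summand never exceeds its leading monomial, and no leading
    monomial exceeds \<open>\<mu>\<close>; so only the summand led by \<open>\<mu>\<close> itself
    contributes there.\<close>
  have lookup_f: "Poly_Mapping.lookup (?f \<beta>) \<mu> = (if \<beta> = \<mu> then c \<mu> else 0)" if \<beta>: "\<beta> \<in> B" for \<beta>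
  proof -
    obtain \<delta> where i: "divisor \<beta> \<in> {1..t}" and \<delta>: "\<beta> = \<delta> + \<gamma> (divisor \<beta>)"
      using divisor Suc.prems(2) \<beta> by blast
    show ?thesis
    proof (cases "\<exists>\<epsilon>. \<mu> = \<delta> + \<epsilon>")
      case True
      then obtain \<epsilon> where \<epsilon>: "\<mu> = \<delta> + \<epsilon>" by blast
      have f: "Poly_Mapping.lookup (?f \<beta>) \<mu> = c \<beta> * Poly_Mapping.lookup (F (divisor \<beta>)) \<epsilon>"
        unfolding \<epsilon> using \<delta> by (metis add_diff_cancel_right' lookup_single_mult_shift)
      show ?thesis
      proof (cases "\<epsilon> = \<gamma> (divisor \<beta>)")
        case True
        then have "\<mu> = \<beta>" using \<epsilon> \<delta> by simp
        then show ?thesis using f True lookup_marked[OF i] by simp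
      next
        case False
        then have "\<mu> \<noteq> \<beta>" using \<epsilon> \<delta> by (metis add_left_cancel)
        then have "prec \<beta> \<mu>" using max[OF \<beta>] prec_total by blast
        then have "\<not> prec \<epsilon> (\<gamma> (divisor \<beta>))"
          using prec_add_left[of \<epsilon> "\<gamma> (divisor \<beta>)" \<delta>] max[OF \<beta>] \<delta> \<epsilon> by metis
        then have "\<epsilon> \<notin> Poly_Mapping.keys (F (divisor \<beta>))"
          using marked_less[OF i] False by blast
        then show ?thesis using f \<open>\<mu> \<noteq> \<beta>\<close> by (simp add: in_keys_iff)
      qed
    next
      case False
      then have "\<beta> \<noteq> \<mu>" using \<delta> by blast
      moreover have "\<beta> - \<gamma> (divisor \<beta>) = \<delta>" using \<delta> by (metis add_diff_cancel_right')
      ultimately show ?thesis using False by (simp add: lookup_single_mult_eq_0)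
    qed
  qed
  have "Poly_Mapping.lookup G \<mu> = (\<Sum>\<beta> \<in> B. if \<beta> = \<mu> then c \<mu> else 0) + Poly_Mapping.lookup H \<mu>"
    unfolding Suc.prems(5) lookup_add lookup_sum using lookup_f by simp
  \<comment> \<open>As \<open>\<mu>\<close> is divisible, the coefficient of \<open>G\<close> at
    \<open>\<mu>\<close> lies in \<open>I\<close>, and so does that of \<open>H\<close>.\<close>
  then have "c \<mu> = Poly_Mapping.lookup G \<mu> + - Poly_Mapping.lookup H \<mu>"
    using \<mu> Suc.prems(1) by simp
  then have c: "c \<mu> \<in> I"
    using add_I[OF Suc.prems(6) uminus_I[OF Suc.prems(4)]] Suc.prems(2) \<mu> by simp
  have "divisor \<mu> \<in> {1..t}" using divisor Suc.prems(2) \<mu> by blast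
  then have f_I: "Poly_Mapping.lookup (?f \<mu>) \<alpha> \<in> I" for \<alpha>
    using mult_I'[OF c lookup_A] by (simp add: lookup_single_mult zero_I)
  have G': "G - ?f \<mu> = sum ?f (B - {\<mu>}) + H"
    unfolding Suc.prems(5) using \<mu> Suc.prems(1) by (simp add: sum.remove)
  \<comment> \<open>All coefficients of the removed summand lie in \<open>I\<close>, so the
    assumption on divisible monomials passes to the shorter sum.\<close>
  have "Poly_Mapping.lookup (G - ?f \<mu>) \<alpha> \<in> I"
  proof (rule Suc.hyps(1)[OF _ _ _ _ _ G'])
    show "n = card (B - {\<mu>})" using Suc.hyps(2) \<mu> Suc.prems(1) by simp
    show "Poly_Mapping.lookup (G - ?f \<mu>) \<alpha> \<in> I" if "divisible \<alpha>" for \<alpha>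
      using add_I[OF Suc.prems(6)[OF that] uminus_I[OF f_I]] by (simp add: lookup_minus)
  qed (use Suc.prems in auto)
  from add_I[OF this f_I[of \<alpha>]] show ?case by (simp add: lookup_minus)
qed

text \<open>The analogue of the fact that a reduced element of an ideal with a Groebner basis is 0,
  with "is 0" replaced by "has coefficients in \<open>I\<close>".\<close>

lemma lookup_in_I_if_low:
  assumes diff: "\<And>i i' \<delta> \<delta>'. i \<in> {1..t} \<Longrightarrow> i' \<in> {1..t} \<Longrightarrow> \<delta> + \<gamma> i = \<delta>' + \<gamma> i' \<Longrightarrow>
      monomial \<delta> * F i - monomial \<delta>' * F i' \<in> low (\<delta> + \<gamma> i)"
    and G: "G \<in> low \<mu>"
    and div: "\<And>\<alpha>. divisible \<alpha> \<Longrightarrow> Poly_Mapping.lookup G \<alpha> \<in> I"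
  shows "Poly_Mapping.lookup G \<alpha> \<in> I"
proof -
  let ?s = "\<lambda>B c. \<Sum>\<beta> \<in> B. Poly_Mapping.single (\<beta> - \<gamma> (divisor \<beta>)) (c \<beta>) * F (divisor \<beta>)"
  have "G \<in> std \<mu>" using low_subset_std[OF diff] G by blast
  from std_repr[OF this] obtain B c where B: "finite B" "\<forall>\<beta> \<in> B. divisible \<beta>" "\<forall>\<beta>. c \<beta> \<in> A"
    and H: "\<And>\<alpha>. Poly_Mapping.lookup (G - ?s B c) \<alpha> \<in> I"
    by (elim exE conjE) (rule that; (assumption | erule spec))
  have "G = ?s B c + (G - ?s B c)" by simp
  from lookup_in_I_if_sum[OF B H this div] show ?thesis .
qed

section \<open>Leading monomials of products and their cancellation in S-polynomials\<close>

lemma keys_single_mult_le: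
  assumes i: "i \<in> {1..t}" and \<beta>: "\<beta> \<in> Poly_Mapping.keys (Poly_Mapping.single \<delta> c * F i)"
  shows "\<beta> = \<delta> + \<gamma> i \<or> prec \<beta> (\<delta> + \<gamma> i)"
proof -
  have "Poly_Mapping.lookup (Poly_Mapping.single \<delta> c * F i) \<beta> \<noteq> 0"
    using \<beta> by (simp add: in_keys_iff)
  then obtain \<alpha> where \<alpha>: "\<beta> = \<delta> + \<alpha>" "\<alpha> \<in> Poly_Mapping.keys (F i)"
    by (auto simp: lookup_single_mult in_keys_iff dest!: mult_not_zero split: if_splits)
  then show ?thesis
    using marked_less[OF i \<alpha>(2)] prec_add_left[of \<alpha> "\<gamma> i" \<delta>] by blast
qed

lemma lookup_single_mult_A: "i \<in> {1..t} \<Longrightarrow> c \<in> A \<Longrightarrow> Poly_Mapping.lookup (Poly_Mapping.single \<delta> c * F i) \<beta> \<in> A"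
  by (simp add: lookup_single_mult zero_A mult_A lookup_A)

text \<open>Both products have coefficient 1 at the lcm, their common leading monomial, so this term
  cancels.\<close>

lemma S_keys_less:
  assumes "i \<in> {1..t}" "j \<in> {1..t}"
    and "\<beta> \<in> Poly_Mapping.keys (monomial (\<gamma> j - \<gamma> i) * F i - monomial (\<gamma> i - \<gamma> j) * F j)"
  shows "prec \<beta> ((\<gamma> j - \<gamma> i) + \<gamma> i)"
proof -
  let ?m = "(\<gamma> j - \<gamma> i) + \<gamma> i"
  have m: "?m = (\<gamma> i - \<gamma> j) + \<gamma> j" by (rule mon_lcm_commute)
  have "Poly_Mapping.lookup (monomial (\<gamma> i - \<gamma> j) * F j) ?m = 1"
    unfolding m using lookup_marked[OF assms(2)] by simp
  then have "Poly_Mapping.lookup (monomial (\<gamma> j - \<gamma> i) * F i - monomial (\<gamma> i - \<gamma> j) * F j) ?m = 0"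
    using lookup_marked[OF assms(1)] by (simp add: lookup_minus)
  then have "\<beta> \<noteq> ?m" using assms(3) by (auto simp: in_keys_iff)
  moreover have "\<beta> \<in> Poly_Mapping.keys (monomial (\<gamma> j - \<gamma> i) * F i) \<union>
      Poly_Mapping.keys (monomial (\<gamma> i - \<gamma> j) * F j)"
    using assms(3) keys_diff by fast
  ultimately show ?thesis
    using keys_single_mult_le[OF assms(1)] keys_single_mult_le[OF assms(2)] m by fastforce
qed

end

section \<open>Ideals of k[C]\<close>

lemma mpoly_ring_simps:
  "mult (mpoly_ring V) = (*)" "one (mpoly_ring V) = 1"
  "zero (mpoly_ring V) = 0" "add (mpoly_ring V) = (+)"
  by (simp_all add: mpoly_ring_def)

text \<open>Restates closure in the ring record with the operations of the type, in the form of the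
  assumptions of \<open>marked_polys\<close>.\<close>

lemma ideal_mpoly_ringD:
  fixes I :: "('v, 'a::comm_ring_1) mpoly set" and V :: "'v set"
  defines "A \<equiv> carrier (mpoly_ring V) :: ('v, 'a) mpoly set"
  assumes "ideal I (mpoly_ring V)"
  shows "0 \<in> I" "x \<in> I \<Longrightarrow> y \<in> I \<Longrightarrow> x + y \<in> I"
    "a \<in> A \<Longrightarrow> x \<in> I \<Longrightarrow> a * x \<in> I"
    "1 \<in> A"
    "a \<in> A \<Longrightarrow> b \<in> A \<Longrightarrow> a + b \<in> A"
    "a \<in> A \<Longrightarrow> b \<in> A \<Longrightarrow> a * b \<in> A"
    "a \<in> A \<Longrightarrow> - a \<in> A"
proof -
  interpret I: ideal I "mpoly_ring V" by fact
  note sub = I.is_additive_subgroup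
  show "0 \<in> I"
    using additive_subgroup.zero_closed[OF sub] unfolding mpoly_ring_simps A_def .
  show "x \<in> I \<Longrightarrow> y \<in> I \<Longrightarrow> x + y \<in> I"
    using additive_subgroup.a_closed[OF sub, of x y] unfolding mpoly_ring_simps A_def .
  show "a \<in> A \<Longrightarrow> x \<in> I \<Longrightarrow> a * x \<in> I"
    using I.I_l_closed[of x a] unfolding mpoly_ring_simps A_def by blast
  show "1 \<in> A"
    using I.one_closed unfolding mpoly_ring_simps A_def .
  show "a \<in> A \<Longrightarrow> b \<in> A \<Longrightarrow> a + b \<in> A"
    using I.add.m_closed[of a b] unfolding mpoly_ring_simps A_def .
  show "a \<in> A \<Longrightarrow> b \<in> A \<Longrightarrow> a * b \<in> A"
    using I.m_closed[of a b] unfolding mpoly_ring_simps A_def .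
  show "a \<in> A \<Longrightarrow> - a \<in> A"
    by (simp add: A_def mpoly_ring_def in_keys_iff)
qed

section \<open>Division steps and complete reductions in k[X,C]\<close>

text \<open>Division by the \<open>F i\<close> depends on \<open>lt\<close> through their leading
  monomials. Keeping \<open>lt\<close> out of \<open>marked_polys\<close> lets two orderings share
  the same sets \<open>low\<close>.\<close>

locale marked_xcpolys = marked_polys prec t \<gamma> "carrier (mpoly_ring V)" I F
  for prec :: "'n::finite mon \<Rightarrow> 'n mon \<Rightarrow> bool" and t \<gamma> and V :: "'n cvar set" and I
    and F :: "nat \<Rightarrow> ('n, 'k::field) xcpoly" +
  fixes lt :: "'n xcmon \<Rightarrow> 'n xcmon \<Rightarrow> bool"
  assumes lead_mon_F: "i \<in> {1..t} \<Longrightarrow> lead_mon lt (F i) = (\<gamma> i, 0)"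
begin

lemma lead_coeff_F: "i \<in> {1..t} \<Longrightarrow> lead_coeff lt (F i) = 1"
  by (simp add: lead_coeff_def lead_mon_F xccoeff_def lookup_marked)

lemma S_poly_F:
  assumes "i \<in> {1..t}" "j \<in> {1..t}"
  shows "S_poly lt (F i) (F j) = monomial (\<gamma> j - \<gamma> i) * F i - monomial (\<gamma> i - \<gamma> j) * F j"
  using assms by (simp add: S_poly_def lead_mon_F lead_coeff_F xcterm_def)

text \<open>The leading X-monomial of the subtracted product occurs in \<open>G\<close> and so is
  below \<open>\<mu>\<close>. The last two conclusions reproduce the assumptions, as iteration
  requires.\<close>

lemma division_step_in_low:
  assumes step: "division_step lt (F ` {1..t}) G H"
    and less: "\<And>\<beta>. \<beta> \<in> Poly_Mapping.keys G \<Longrightarrow> prec \<beta> \<mu>"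
    and coeffs: "\<And>\<beta>. Poly_Mapping.lookup G \<beta> \<in> carrier (mpoly_ring V)"
  shows "G - H \<in> low \<mu>"
    and "\<beta> \<in> Poly_Mapping.keys H \<Longrightarrow> prec \<beta> \<mu>"
    and "Poly_Mapping.lookup H \<beta> \<in> carrier (mpoly_ring V)"
proof -
  obtain i q where i: "i \<in> {1..t}" and nz: "xccoeff G (q + (\<gamma> i, 0)) \<noteq> 0"
    and H: "H = G - xcterm (xccoeff G (q + (\<gamma> i, 0))) q * F i"
    using step by (auto simp: division_step_def lead_mon_F lead_coeff_F)
  define c where "c = Poly_Mapping.single (snd q) (xccoeff G (q + (\<gamma> i, 0)))"
  have H: "H = G - Poly_Mapping.single (fst q) c * F i"
    unfolding H c_def xcterm_def ..
  have key: "fst q + \<gamma> i \<in> Poly_Mapping.keys G"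
    and key': "snd q \<in> Poly_Mapping.keys (Poly_Mapping.lookup G (fst q + \<gamma> i))"
    using nz by (auto simp: xccoeff_def in_keys_iff)
  \<comment> \<open>\<open>c\<close> is a single term of an X-coefficient of \<open>G\<close>, so
    its variables lie in \<open>V\<close>.\<close>
  have c: "c \<in> carrier (mpoly_ring V)"
    using coeffs[of "fst q + \<gamma> i"] key' by (auto simp: mpoly_ring_def c_def)
  have top: "prec (fst q + \<gamma> i) \<mu>" by (rule less[OF key])
  show "G - H \<in> low \<mu>"
    unfolding H using multiples.multiple[OF i _ c, of _ "fst q"] top by simp
  show "prec \<beta> \<mu>" if "\<beta> \<in> Poly_Mapping.keys H"
  proof -
    have "\<beta> \<in> Poly_Mapping.keys G \<or> \<beta> \<in> Poly_Mapping.keys (Poly_Mapping.single (fst q) c * F i)"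
      using that keys_diff[of G "Poly_Mapping.single (fst q) c * F i"] unfolding H by blast
    then show ?thesis
    proof
      assume "\<beta> \<in> Poly_Mapping.keys (Poly_Mapping.single (fst q) c * F i)"
      from keys_single_mult_le[OF i this] show ?thesis
        using top prec_trans[OF _ top] by blast
    qed (rule less)
  qed
  show "Poly_Mapping.lookup H \<beta> \<in> carrier (mpoly_ring V)"
    using add_A[OF coeffs uminus_A[OF lookup_single_mult_A[OF i c]]] by (simp add: H lookup_minus)
qed

lemma division_steps_in_low:
  assumes "(division_step lt (F ` {1..t}))\<^sup>*\<^sup>* G H"
    and "\<And>\<beta>. \<beta> \<in> Poly_Mapping.keys G \<Longrightarrow> prec \<beta> \<mu>"
    and "\<And>\<beta>. Poly_Mapping.lookup G \<beta> \<in> carrier (mpoly_ring V)"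
  shows "G - H \<in> low \<mu>"
proof -
  have "G - H \<in> low \<mu> \<and> (\<forall>\<beta> \<in> Poly_Mapping.keys H. prec \<beta> \<mu>) \<and>
      (\<forall>\<beta>. Poly_Mapping.lookup H \<beta> \<in> carrier (mpoly_ring V))"
    using assms(1)
  proof induction
    case base
    then show ?case using assms(2,3) by (simp add: multiples_zero)
  next
    case (step H K)
    have less: "\<And>\<beta>. \<beta> \<in> Poly_Mapping.keys H \<Longrightarrow> prec \<beta> \<mu>"
      and coeffs: "\<And>\<beta>. Poly_Mapping.lookup H \<beta> \<in> carrier (mpoly_ring V)"
      using step.IH by auto
    note d = division_step_in_low[OF step.hyps(2) less coeffs]
    have "(G - H) + (H - K) \<in> low \<mu>"
      using step.IH d(1) by (intro multiples.plus) auto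
    then show ?case using d(2,3) by simp
  qed
  then show ?thesis by blast
qed

lemma S_minus_reduction_in_low:
  assumes "i \<in> {1..t}" "j \<in> {1..t}"
    and "complete_reduction lt \<jj> (F ` {1..t}) (S_poly lt (F i) (F j)) R"
  shows "monomial (\<gamma> j - \<gamma> i) * F i - monomial (\<gamma> i - \<gamma> j) * F j - R \<in> low ((\<gamma> j - \<gamma> i) + \<gamma> i)"
proof (rule division_steps_in_low)
  show "(division_step lt (F ` {1..t}))\<^sup>*\<^sup>* (monomial (\<gamma> j - \<gamma> i) * F i - monomial (\<gamma> i - \<gamma> j) * F j) R"
    using assms by (simp add: complete_reduction_def S_poly_F)
  show "Poly_Mapping.lookup (monomial (\<gamma> j - \<gamma> i) * F i - monomial (\<gamma> i - \<gamma> j) * F j) \<beta>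
      \<in> carrier (mpoly_ring V)" for \<beta>
    using add_A[OF lookup_single_mult_A[OF assms(1) one_A]
        uminus_A[OF lookup_single_mult_A[OF assms(2) one_A]]] by (simp add: lookup_minus)
qed (rule S_keys_less[OF assms(1,2)])

end

section \<open>Comparison of two choices in the construction\<close>

lemma lookup_generic_poly:
  assumes "finite (T i)" "\<gamma> i \<notin> T i"
  shows "Poly_Mapping.lookup (generic_poly \<gamma> T i :: ('n, 'k::field) xcpoly) \<beta> =
    (if \<beta> = \<gamma> i then 1 else if \<beta> \<in> T i then monomial (pvar (i, \<beta>)) else 0)"
  using assms by (auto simp: generic_poly_def lookup_add lookup_sum lookup_single when_def sum.delta)

lemma monomial_in_genideal:
  assumes "\<beta> = \<delta> + \<gamma> i" "i \<in> S"
  shows "(monomial \<beta> :: ('n, 'k::field) mpoly) \<in> genideal (mpoly_ring UNIV) ((\<lambda>i. monomial (\<gamma> i)) ` S)"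
proof -
  have "monomial \<beta> \<in> K" if "ideal K (mpoly_ring UNIV)" "(\<lambda>i. monomial (\<gamma> i)) ` S \<subseteq> K"
    for K :: "('n, 'k) mpoly set"
  proof -
    have "monomial \<delta> * monomial (\<gamma> i) \<in> K"
      using that assms(2) by (intro ideal_mpoly_ringD(3)[OF that(1)]) (auto simp: mpoly_ring_def)
    then show ?thesis by (simp add: assms(1) mult_single)
  qed
  then show ?thesis by (auto simp: genideal_def)
qed

lemma stratum_choiceD:
  fixes prec :: "'n mon \<Rightarrow> 'n mon \<Rightarrow> bool" and \<jj> :: "('n, 'k::field) mpoly set"
  assumes "stratum_choice prec \<jj> t \<gamma> T lt P R"
  shows "i \<in> {1..t} \<Longrightarrow> lead_mon lt (generic_poly \<gamma> T i :: ('n, 'k) xcpoly) = (\<gamma> i, 0)"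
    and "P \<subseteq> {(i, j). 1 \<le> i \<and> i < j \<and> j \<le> t}"
    and "generates_syzygies t \<gamma> P TYPE('k)"
    and "(i, j) \<in> P \<Longrightarrow> i \<in> {1..t}"
    and "(i, j) \<in> P \<Longrightarrow> j \<in> {1..t}"
    and "(i, j) \<in> P \<Longrightarrow> complete_reduction lt \<jj> (generic_poly \<gamma> T ` {1..t})
      (S_poly lt (generic_poly \<gamma> T i) (generic_poly \<gamma> T j)) (R (i, j))"
proof -
  have P: "P \<subseteq> {(i, j). 1 \<le> i \<and> i < j \<and> j \<le> t}" and "xc_order prec t \<gamma> T TYPE('k) lt"
    and gen: "generates_syzygies t \<gamma> P TYPE('k)"
    and red: "\<forall>(i, j) \<in> P. complete_reduction lt \<jj> (generic_poly \<gamma> T ` {1..t})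
       (S_poly lt (generic_poly \<gamma> T i) (generic_poly \<gamma> T j)) (R (i, j))"
    using assms unfolding stratum_choice_def by simp_all
  then show "i \<in> {1..t} \<Longrightarrow> lead_mon lt (generic_poly \<gamma> T i :: ('n, 'k) xcpoly) = (\<gamma> i, 0)"
    unfolding xc_order_def by blast
  show "P \<subseteq> {(i, j). 1 \<le> i \<and> i < j \<and> j \<le> t}" "generates_syzygies t \<gamma> P TYPE('k)"
    by fact+
  show "(i, j) \<in> P \<Longrightarrow> i \<in> {1..t}" "(i, j) \<in> P \<Longrightarrow> j \<in> {1..t}"
    using P by auto
  show "(i, j) \<in> P \<Longrightarrow> complete_reduction lt \<jj> (generic_poly \<gamma> T ` {1..t})
      (S_poly lt (generic_poly \<gamma> T i) (generic_poly \<gamma> T j)) (R (i, j))"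
    using red by fast
qed

text \<open>The unprimed choice establishes the Buchberger condition modulo \<open>I\<close>; the
  primed choice supplies the reduced polynomials to which it is applied.\<close>

lemma stratum_ideal_subset:
  fixes prec :: "'n::finite mon \<Rightarrow> 'n mon \<Rightarrow> bool"
    and \<jj> :: "('n, 'k::field) mpoly set"
  assumes prec: "term_order UNIV prec"
    and basis: "monomial_basis \<jj> t \<gamma>"
    and T: "\<forall>i \<in> {1..t}. finite (T i) \<and> T i \<subseteq> tail prec \<jj> (\<gamma> i)"
    and choice: "stratum_choice prec \<jj> t \<gamma> T lt P R"
    and choice': "stratum_choice prec \<jj> t \<gamma> T lt' P' R'"
  shows "stratum_ideal t T P' R' \<subseteq> stratum_ideal t T P R"
proof -
  let ?F = "generic_poly \<gamma> T :: nat \<Rightarrow> ('n, 'k) xcpoly"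
  let ?A = "carrier (mpoly_ring (Cvars t T)) :: ('n cvar, 'k) mpoly set"
  note D = stratum_choiceD[OF choice] and D' = stratum_choiceD[OF choice']
  have less: "prec \<alpha> (\<gamma> i)" if "i \<in> {1..t}" "\<alpha> \<in> T i" for i \<alpha>
    using T that by (auto simp: tail_def)
  have lookup_F: "Poly_Mapping.lookup (?F i) \<beta> =
      (if \<beta> = \<gamma> i then 1 else if \<beta> \<in> T i then monomial (pvar (i, \<beta>)) else 0)"
    if i: "i \<in> {1..t}" for i \<beta>
  proof (rule lookup_generic_poly)
    show "finite (T i)" using T i by blast
    have "\<not> prec (\<gamma> i) (\<gamma> i)"
      using prec unfolding term_order_def irreflp_on_def by blast
    then show "\<gamma> i \<notin> T i" using less[OF i] by blast
  qed
  have "Poly_Mapping.lookup (R' p) \<alpha> \<in> I"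
    if I: "ideal I (mpoly_ring (Cvars t T))" and p: "p \<in> P'"
      and gens: "{Poly_Mapping.lookup (R p) \<alpha> | p \<alpha>. p \<in> P \<and> \<alpha> \<in> Poly_Mapping.keys (R p)} \<subseteq> I"
    for I p \<alpha>
  proof -
    note ID = ideal_mpoly_ringD[OF I]
    interpret marked_polys prec t \<gamma> ?A I ?F
    proof
      fix i \<alpha> assume i: "i \<in> {1..t}"
      show "Poly_Mapping.lookup (?F i) (\<gamma> i) = 1" by (simp add: lookup_F[OF i])
      show "Poly_Mapping.lookup (?F i) \<alpha> \<in> ?A"
        using i by (auto simp: lookup_F[OF i] mpoly_ring_def Cvars_def)
      show "prec \<alpha> (\<gamma> i)" if "\<alpha> \<in> Poly_Mapping.keys (?F i)" "\<alpha> \<noteq> \<gamma> i"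
        using that less[OF i] by (auto simp: in_keys_iff lookup_F[OF i] split: if_splits)
    qed (rule prec ID; assumption)+
    \<comment> \<open>Both orderings are interpreted over the same \<open>marked_polys\<close>, so
      \<open>low\<close> has the same meaning for \<open>R\<close> and for
      \<open>R'\<close>.\<close>
    interpret X: marked_xcpolys prec t \<gamma> "Cvars t T" I ?F lt
      by unfold_locales (rule D(1))
    interpret X': marked_xcpolys prec t \<gamma> "Cvars t T" I ?F lt'
      by unfold_locales (rule D'(1))
    have divisible_in: "monomial \<alpha> \<in> \<jj>" if \<alpha>: "divisible \<alpha>" for \<alpha>
    proof -
      obtain i \<delta> where "i \<in> {1..t}" "\<alpha> = \<delta> + \<gamma> i"
        using \<alpha> unfolding divisible_def by blast
      then show ?thesis
        using basis monomial_in_genideal[of \<alpha> \<delta> \<gamma> i "{1..t}"] by (simp add: monomial_basis_def)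
    qed
    obtain i' j' where p_def: "p = (i', j')" by (cases p)
    note ij' = D'(4)[OF p[unfolded p_def]] D'(5)[OF p[unfolded p_def]]
    note R'_red = D'(6)[OF p[unfolded p_def], folded p_def]
    have S_low: "monomial (\<gamma> j - \<gamma> i) * ?F i - monomial (\<gamma> i - \<gamma> j) * ?F j \<in> low ((\<gamma> j - \<gamma> i) + \<gamma> i)"
      if ij: "(i, j) \<in> P" for i j
    proof -
      \<comment> \<open>The nonzero X-coefficients are among the generators, so the remainder is
        null modulo \<open>I\<close>.\<close>
      have "R (i, j) \<in> low ((\<gamma> j - \<gamma> i) + \<gamma> i)"
      proof (rule multiples.null)
        show "Poly_Mapping.lookup (R (i, j)) \<beta> \<in> I" for \<beta>
        proof (cases "\<beta> \<in> Poly_Mapping.keys (R (i, j))")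
          case True
          then show ?thesis using gens ij by blast
        next
          case False
          then show ?thesis using zero_I by (simp add: in_keys_iff)
        qed
      qed
      from multiples.plus[OF X.S_minus_reduction_in_low[OF D(4)[OF ij] D(5)[OF ij] D(6)[OF ij]] this]
      show ?thesis by simp
    qed
    have diff: "monomial \<delta> * ?F i - monomial \<delta>' * ?F j \<in> low (\<delta> + \<gamma> i)"
      if "i \<in> {1..t}" "j \<in> {1..t}" "\<delta> + \<gamma> i = \<delta>' + \<gamma> j" for i j \<delta> \<delta>'
      using D(3,2) S_low that by (rule monomial_mult_diff_in_low)
    \<comment> \<open>The pair need not belong to \<open>P\<close>, hence the appeal to
      \<open>diff\<close>. Subtracting what the division removed leaves \<open>R' p\<close>.\<close>
    have "monomial (\<gamma> j' - \<gamma> i') * ?F i' - monomial (\<gamma> i' - \<gamma> j') * ?F j' -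
        (monomial (\<gamma> j' - \<gamma> i') * ?F i' - monomial (\<gamma> i' - \<gamma> j') * ?F j' - R' p)
        \<in> low ((\<gamma> j' - \<gamma> i') + \<gamma> i')"
      by (rule multiples_diff[OF diff[OF ij' mon_lcm_commute] X'.S_minus_reduction_in_low[OF ij' R'_red]])
    then have low: "R' p \<in> low ((\<gamma> j' - \<gamma> i') + \<gamma> i')" by simp
    \<comment> \<open>The reduction is complete, so the coefficients at monomials of
      \<open>\<jj>\<close> are 0.\<close>
    have "Poly_Mapping.lookup (R' p) \<alpha> \<in> I" if "divisible \<alpha>" for \<alpha>
    proof -
      have "\<alpha> \<notin> Poly_Mapping.keys (R' p)"
        using R'_red divisible_in[OF that] by (auto simp: complete_reduction_def)
      then show ?thesis using zero_I by (simp add: in_keys_iff)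
    qed
    from lookup_in_I_if_low[OF diff low this] show ?thesis .
  qed
  then show ?thesis
    unfolding stratum_ideal_def genideal_def by blast
qed

theorem theoremA:
  fixes prec :: "'n::{finite,linorder} mon \<Rightarrow> 'n mon \<Rightarrow> bool"
    and \<jj> :: "('n, 'k::field) mpoly set"
    and t :: nat and \<gamma> :: "nat \<Rightarrow> 'n mon" and T :: "nat \<Rightarrow> 'n mon set"
    and lt lt' :: "'n xcmon \<Rightarrow> 'n xcmon \<Rightarrow> bool"
    and P P' :: "(nat \<times> nat) set"
    and R R' :: "nat \<times> nat \<Rightarrow> ('n, 'k) xcpoly"
  assumes "term_order UNIV prec"
    and "\<forall>a b :: 'n. a < b \<longrightarrow> prec (pvar b) (pvar a)"
    and "monomial_basis \<jj> t \<gamma>"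
    and "\<forall>i \<in> {1..t}. finite (T i) \<and> T i \<subseteq> tail prec \<jj> (\<gamma> i)"
    and "stratum_choice prec \<jj> t \<gamma> T lt P R"
    and "stratum_choice prec \<jj> t \<gamma> T lt' P' R'"
  shows "stratum_ideal t T P R = stratum_ideal t T P' R'"
  using assms stratum_ideal_subset by blast

end
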